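(* Let $A\in\mathbb{C}^{N\times N}$ be a complex symmetric matrix, let $\sigma\in\mathbb{C}$ and let $b\in\mathbb{C}^N$. Let $r_0,r_1,\dots$ be the residual vectors produced by the COCG method applied to $Ax=b$ with initial guess $x_0=0$, and let $r_0^{\sigma},r_1^{\sigma},\dots$ be the residual vectors produced by the COCG method applied to $(A+\sigma I)x=b$ with initial guess $x_0^{\sigma}=0$. Let $n\ge 0$ be such that neither of the two runs breaks down before its $n$-th residual is computed. Then $r_n$ and $r_n^{\sigma}$ are collinear, i.e. there exists $\pi_n^{\sigma}\in\mathbb{C}$ such that $r_n=\pi_n^{\sigma}\, r_n^{\sigma}$.
   Context: A matrix $A\in\mathbb{C}^{N\times N}$ is called complex symmetric if it is symmetric but not Hermitian: $A=A^T\ne A^H$. Here $v^T$ denotes the plain transpose (no complex conjugation). The COCG (Conjugate Orthogonal Conjugate Gradient) method for a linear system $Bx=b$ with $B=B^T\in\mathbb{C}^{N\times N}$ and initial guess $x_0$ is the following iteration, considered in exact arithmetic. Set $r_0=b-Bx_0$, $p_{-1}=0$, $\beta_{-1}=0$, and for $k=0,1,2,\dots$ compute $$p_k=r_k+\beta_{k-1}p_{k-1},\qquad \alpha_k=\frac{r_k^T r_k}{p_k^T B p_k},$$ $$x_{k+1}=x_k+\alpha_k p_k,\qquad r_{k+1}=r_k-\alpha_k B p_k,\qquad \beta_k=\frac{r_{k+1}^T r_{k+1}}{r_k^T r_k}.$$ The vectors $r_k$ (which satisfy $r_k=b-Bx_k$) are the COCG residual vectors. For the second run the method is applied with $B=A+\sigma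 I$, and its residuals are denoted $r_k^{\sigma}$. A run does not break down before its $n$-th residual is computed if $r_k^T r_k\neq 0$ and $p_k^T B p_k\ne 0$ for all $0\le k<n$. *)

theory Defs
  imports "HOL-Analysis.Analysis"
begin

text \<open>Conjugate transpose; \<open>transpose\<close> is the plain transpose.\<close>

definition conj_transpose :: "complex ^ 'n ^ 'm \<Rightarrow> complex ^ 'm ^ 'n"
  where "conj_transpose A = map_matrix cnj (transpose A)"

definition complex_symmetric :: "complex ^ 'n ^ 'n \<Rightarrow> bool"
  where "complex_symmetric A \<longleftrightarrow> A = transpose A \<and> A \<noteq> conj_transpose A"

text \<open>The bilinear form \<open>u\<^sup>T v\<close>, without conjugation; the library's inner product on
  complex vectors is a different, real-valued form.\<close>

definition tdot :: "complex ^ 'n \<Rightarrow> complex ^ 'n \<Rightarrow> complex"  (infixl "\<bullet>\<^sub>T" 70)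
  where "u \<bullet>\<^sub>T v = (\<Sum>i\<in>UNIV. u $ i * v $ i)"

text \<open>The state before step \<open>k\<close> is \<open>(x\<^sub>k, r\<^sub>k, p\<^sub>k\<^sub>-\<^sub>1, \<beta>\<^sub>k\<^sub>-\<^sub>1)\<close>, which
  accommodates the starting values with index \<open>-1\<close>. After a breakdown, division by zero
  makes the iterates meaningless.\<close>

type_synonym 'n cocg_state = "(complex ^ 'n) \<times> (complex ^ 'n) \<times> (complex ^ 'n) \<times> complex"

definition cocg_step :: "complex ^ 'n ^ 'n \<Rightarrow> 'n cocg_state \<Rightarrow> 'n cocg_state"
  where "cocg_step B = (\<lambda>(x, r, p', \<beta>').
     let p = r + \<beta>' *s p';
         \<alpha> = (r \<bullet>\<^sub>T r) / (p \<bullet>\<^sub>T (B *v p));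
         x1 = x + \<alpha> *s p;
         r1 = r - \<alpha> *s (B *v p);
         \<beta> = (r1 \<bullet>\<^sub>T r1) / (r \<bullet>\<^sub>T r)
     in (x1, r1, p, \<beta>))"

primrec cocg :: "complex ^ 'n ^ 'n \<Rightarrow> complex ^ 'n \<Rightarrow> complex ^ 'n \<Rightarrow> nat \<Rightarrow> 'n cocg_state"
  where
    "cocg B b x0 0 = (x0, b - B *v x0, 0, 0)"
  | "cocg B b x0 (Suc k) = cocg_step B (cocg B b x0 k)"

definition cocg_iterate :: "complex ^ 'n ^ 'n \<Rightarrow> complex ^ 'n \<Rightarrow> complex ^ 'n \<Rightarrow> nat \<Rightarrow> complex ^ 'n"
  where "cocg_iterate B b x0 k = (case cocg B b x0 k of (x, r, p', \<beta>') \<Rightarrow> x)"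

definition cocg_residual :: "complex ^ 'n ^ 'n \<Rightarrow> complex ^ 'n \<Rightarrow> complex ^ 'n \<Rightarrow> nat \<Rightarrow> complex ^ 'n"
  where "cocg_residual B b x0 k = (case cocg B b x0 k of (x, r, p', \<beta>') \<Rightarrow> r)"

definition cocg_direction :: "complex ^ 'n ^ 'n \<Rightarrow> complex ^ 'n \<Rightarrow> complex ^ 'n \<Rightarrow> nat \<Rightarrow> complex ^ 'n"
  where "cocg_direction B b x0 k = (case cocg B b x0 k of (x, r, p', \<beta>') \<Rightarrow> r + \<beta>' *s p')"

definition cocg_alpha :: "complex ^ 'n ^ 'n \<Rightarrow> complex ^ 'n \<Rightarrow> complex ^ 'n \<Rightarrow> nat \<Rightarrow> complex"
  where "cocg_alpha B b x0 k =
    (cocg_residual B b x0 k \<bullet>\<^sub>T cocg_residual B b x0 k) /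
    (cocg_direction B b x0 k \<bullet>\<^sub>T (B *v cocg_direction B b x0 k))"

definition cocg_beta :: "complex ^ 'n ^ 'n \<Rightarrow> complex ^ 'n \<Rightarrow> complex ^ 'n \<Rightarrow> nat \<Rightarrow> complex"
  where "cocg_beta B b x0 k =
    (cocg_residual B b x0 (Suc k) \<bullet>\<^sub>T cocg_residual B b x0 (Suc k)) /
    (cocg_residual B b x0 k \<bullet>\<^sub>T cocg_residual B b x0 k)"

definition cocg_no_breakdown ::
    "complex ^ 'n ^ 'n \<Rightarrow> complex ^ 'n \<Rightarrow> complex ^ 'n \<Rightarrow> nat \<Rightarrow> bool"
  where "cocg_no_breakdown B b x0 n \<longleftrightarrow>
    (\<forall>k<n. cocg_residual B b x0 k \<bullet>\<^sub>T cocg_residual B b x0 k \<noteq> 0 \<and>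
           cocg_direction B b x0 k \<bullet>\<^sub>T (B *v cocg_direction B b x0 k) \<noteq> 0)"

lemma cocg_0:
  "cocg_iterate B b x0 0 = x0"
  "cocg_residual B b x0 0 = b - B *v x0"
  "cocg_direction B b x0 0 = cocg_residual B b x0 0"
  by (simp_all add: cocg_iterate_def cocg_residual_def cocg_direction_def)

lemma cocg_Suc:
  "cocg_iterate B b x0 (Suc k) = cocg_iterate B b x0 k + cocg_alpha B b x0 k *s cocg_direction B b x0 k"
  "cocg_residual B b x0 (Suc k) =
     cocg_residual B b x0 k - cocg_alpha B b x0 k *s (B *v cocg_direction B b x0 k)"
  "cocg_direction B b x0 (Suc k) =
     cocg_residual B b x0 (Suc k) + cocg_beta B b x0 k *s cocg_direction B b x0 k"
  by (simp_all add: cocg_iterate_def cocg_residual_def cocg_direction_def cocg_alpha_def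
        cocg_beta_def cocg_step_def Let_def split: prod.splits)

lemma cocg_residual_eq: "cocg_residual B b x0 k = b - B *v cocg_iterate B b x0 k"
  by (induction k) (simp_all add: cocg_0 cocg_Suc matrix_vector_right_distrib
        vector_scalar_commute)

end

theory Submission
  imports Defs
begin

text \<open>As long as a run does not break down, its residuals are mutually orthogonal for
  the bilinear form \<open>u\<^sup>T v\<close>, and the first \<open>k\<close> of them span the \<open>k\<close>-th Krylov space of \<open>b\<close>.
  Krylov spaces do not change under a shift of the matrix, so the \<open>n\<close>-th residuals of both runs
  lie in the same \<open>n+1\<close>-st Krylov space and are orthogonal to the same \<open>n\<close>-th one. On the latter
  the form is nondegenerate, because it has an orthogonal spanning set of non-isotropic
  residuals; hence the two residuals are collinear.\<close>

section \<open>The bilinear form without conjugation\<close>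

lemma tdot_commute: "u \<bullet>\<^sub>T v = v \<bullet>\<^sub>T u"
  by (simp add: tdot_def mult.commute)

lemma tdot_linear_left:
  "(u + v) \<bullet>\<^sub>T w = u \<bullet>\<^sub>T w + v \<bullet>\<^sub>T w"
  "(u - v) \<bullet>\<^sub>T w = u \<bullet>\<^sub>T w - v \<bullet>\<^sub>T w"
  "(c *s u) \<bullet>\<^sub>T w = c * (u \<bullet>\<^sub>T w)"
  "0 \<bullet>\<^sub>T w = 0"
  by (simp_all add: tdot_def algebra_simps sum.distrib sum_subtractf sum_distrib_left)

lemma tdot_linear_right:
  "w \<bullet>\<^sub>T (u + v) = w \<bullet>\<^sub>T u + w \<bullet>\<^sub>T v"
  "w \<bullet>\<^sub>T (u - v) = w \<bullet>\<^sub>T u - w \<bullet>\<^sub>T v"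
  "w \<bullet>\<^sub>T (c *s u) = c * (w \<bullet>\<^sub>T u)"
  "w \<bullet>\<^sub>T 0 = 0"
  by (simp_all add: tdot_commute[of w] tdot_linear_left)

lemmas tdot_linear = tdot_linear_left tdot_linear_right

lemma tdot_matrix_vector_mult: "u \<bullet>\<^sub>T (B *v v) = (transpose B *v u) \<bullet>\<^sub>T v"
  unfolding tdot_def matrix_vector_mult_def transpose_def
  by (simp add: sum_distrib_left sum_distrib_right, subst sum.swap) (simp add: ac_simps)

lemma tdot_eq_0_on_span:
  assumes "\<And>v. v \<in> S \<Longrightarrow> u \<bullet>\<^sub>T v = 0" and "w \<in> vec.span S"
  shows "u \<bullet>\<^sub>T w = 0"
  using assms(2)
  by (induction rule: vec.span_induct_alt) (simp_all add: tdot_linear assms(1))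

text \<open>The form has nonzero isotropic vectors, so \<open>v \<bullet>\<^sub>T v = 0\<close>
  would not suffice. Instead, pairing \<open>v\<close> with the last vector \<open>r n\<close>
  isolates its coefficient there, which vanishes as \<open>r n\<close> is not isotropic; induction
  strips off the remaining vectors.\<close>

lemma orthogonal_span_nondegenerate:
  fixes n :: nat
  assumes "\<And>i j. i < j \<Longrightarrow> j < n \<Longrightarrow> r i \<bullet>\<^sub>T r j = 0"
    and "\<And>j. j < n \<Longrightarrow> r j \<bullet>\<^sub>T r j \<noteq> 0"
    and "v \<in> vec.span (r ` {..<n})"
    and "\<And>j. j < n \<Longrightarrow> r j \<bullet>\<^sub>T v = 0"
  shows "v = 0"
  using assms
proof (induction n)
  case (Suc n)
  obtain c where c: "v - c *s r n \<in> vec.span (r ` {..<n})"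
    using Suc.prems(3) vec.span_breakdown_eq[of v "r n" "r ` {..<n}"]
    by (auto simp: lessThan_Suc)
  have "r n \<bullet>\<^sub>T (v - c *s r n) = 0"
    by (rule tdot_eq_0_on_span[OF _ c])
      (use Suc.prems(1) in \<open>auto simp: tdot_commute[of "r n"]\<close>)
  then have "c = 0"
    using Suc.prems(2)[of n] Suc.prems(4)[of n] by (simp add: tdot_linear)
  then show ?case
    using Suc c by simp
qed simp

section \<open>Orthogonal residuals and conjugate directions\<close>

lemma cocg_no_breakdownD:
  assumes "cocg_no_breakdown B b x0 n" "k < n"
  shows "cocg_residual B b x0 k \<bullet>\<^sub>T cocg_residual B b x0 k \<noteq> 0"
    and "cocg_direction B b x0 k \<bullet>\<^sub>T (B *v cocg_direction B b x0 k) \<noteq> 0"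
    and "cocg_alpha B b x0 k \<noteq> 0"
  using assms by (auto simp: cocg_no_breakdown_def cocg_alpha_def)

lemma matrix_mult_cocg_direction:
  assumes "cocg_no_breakdown B b x0 n" "k < n"
  shows "B *v cocg_direction B b x0 k =
    (1 / cocg_alpha B b x0 k) *s (cocg_residual B b x0 k - cocg_residual B b x0 (Suc k))"
  using cocg_no_breakdownD[OF assms] by (simp add: cocg_Suc)

text \<open>The two claims need a joint induction on the larger index: a new residual is orthogonal
  because the old directions are conjugate, and a new direction is conjugate because the new
  residual is orthogonal.\<close>

lemma cocg_orthogonal:
  assumes sym: "transpose B = B" and nb: "cocg_no_breakdown B b x0 n"
    and "k \<le> n" "i < k"
  shows "cocg_residual B b x0 i \<bullet>\<^sub>T cocg_residual B b x0 k = 0 \<and>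
    cocg_direction B b x0 i \<bullet>\<^sub>T (B *v cocg_direction B b x0 k) = 0"
  using assms(3,4)
proof (induction k arbitrary: i)
  case (Suc k)
  define r where "r = cocg_residual B b x0"
  define p where "p = cocg_direction B b x0"
  define \<alpha> where "\<alpha> = cocg_alpha B b x0"
  define \<beta> where "\<beta> = cocg_beta B b x0"
  have nz: "r k \<bullet>\<^sub>T r k \<noteq> 0" "p k \<bullet>\<^sub>T (B *v p k) \<noteq> 0"
    using cocg_no_breakdownD[OF nb] Suc.prems by (auto simp: r_def p_def)
  have rSuc: "r (Suc j) = r j - \<alpha> j *s (B *v p j)" for j
    by (simp add: r_def p_def \<alpha>_def cocg_Suc)
  have pSuc: "p (Suc j) = r (Suc j) + \<beta> j *s p j" for j
    by (simp add: r_def p_def \<beta>_def cocg_Suc)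
  have Bp: "B *v p j = (1 / \<alpha> j) *s (r j - r (Suc j))" if "j < n" for j
    unfolding r_def p_def \<alpha>_def by (rule matrix_mult_cocg_direction[OF nb that])
  have \<alpha>: "\<alpha> k = (r k \<bullet>\<^sub>T r k) / (p k \<bullet>\<^sub>T (B *v p k))"
    by (simp add: \<alpha>_def r_def p_def cocg_alpha_def)
  have \<beta>: "\<beta> k = (r (Suc k) \<bullet>\<^sub>T r (Suc k)) / (r k \<bullet>\<^sub>T r k)"
    by (simp add: \<beta>_def r_def cocg_beta_def)
  have IH: "r j \<bullet>\<^sub>T r k = 0" "p j \<bullet>\<^sub>T (B *v p k) = 0" if "j < k" for j
    using Suc.IH[of j] Suc.prems that by (auto simp: r_def p_def)
  \<comment> \<open>\<open>r j\<close> and \<open>p j\<close> differ by a multiple of the previous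
    direction, which is conjugate to \<open>p k\<close>; for \<open>j = 0\<close> they
    coincide.\<close>
  have rBp: "r j \<bullet>\<^sub>T (B *v p k) = p j \<bullet>\<^sub>T (B *v p k)" if "j \<le> k" for j
  proof (cases j)
    case 0
    then show ?thesis by (simp add: r_def p_def cocg_0)
  next
    case (Suc l)
    then show ?thesis using IH(2)[of l] that by (simp add: pSuc tdot_linear)
  qed
  \<comment> \<open>For \<open>j < k\<close> both terms of the recurrence vanish; for
    \<open>j = k\<close> they cancel by the choice of \<open>\<alpha> k\<close>.\<close>
  have rr: "r j \<bullet>\<^sub>T r (Suc k) = 0" if "j \<le> k" for j
    using that IH[of j] nz rBp[OF that]
    by (cases "j = k") (simp_all add: rSuc tdot_linear \<alpha>)
  \<comment> \<open>Symmetry moves \<open>B\<close> onto \<open>p i\<close>, where \<open>Bp\<close>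
    can turn it into residuals.\<close>
  have "p i \<bullet>\<^sub>T (B *v p (Suc k)) = r (Suc k) \<bullet>\<^sub>T (B *v p i) + \<beta> k * (p i \<bullet>\<^sub>T (B *v p k))"
    unfolding pSuc matrix_vector_right_distrib vector_scalar_commute tdot_linear
    by (subst tdot_matrix_vector_mult) (simp add: sym tdot_commute)
  also have "\<dots> = 0"
  proof (cases "i = k")
    \<comment> \<open>Here the choice of \<open>\<beta> k\<close> cancels the two terms.\<close>
    case True
    have "r (Suc k) \<bullet>\<^sub>T (B *v p k) = - (r (Suc k) \<bullet>\<^sub>T r (Suc k)) / \<alpha> k"
      using Bp[of k] rr[of k] Suc.prems by (simp add: tdot_linear tdot_commute[of _ "r k"])
    then show ?thesis
      using nz by (simp add: True \<alpha> \<beta>)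
  next
    \<comment> \<open>Now \<open>Suc i \<le> k\<close>, so \<open>B *v p i\<close> combines two
      residuals that are both orthogonal to \<open>r (Suc k)\<close>.\<close>
    case False
    then show ?thesis
      using Suc.prems Bp[of i] rr[of i] rr[of "Suc i"] IH(2)[of i]
      by (simp add: tdot_linear tdot_commute[of "r (Suc k)"])
  qed
  finally show ?case
    using rr[of i] Suc.prems by (simp add: r_def p_def)
qed simp

section \<open>Krylov spaces, represented as spans of residuals\<close>

lemma cocg_direction_in_span:
  "cocg_direction B b x0 k \<in> vec.span (cocg_residual B b x0 ` {..k})"
proof (induction k)
  case 0
  then show ?case by (simp add: cocg_0 vec.span_base)
next
  case (Suc k)
  have "cocg_direction B b x0 k \<in> vec.span (cocg_residual B b x0 ` {..Suc k})"
    by (rule subsetD[OF vec.span_mono Suc]) auto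
  then show ?case
    by (simp add: cocg_Suc(3) vec.span_add vec.span_scale vec.span_base)
qed

text \<open>A residual is a combination of at most two consecutive directions, and \<open>B\<close>
  sends each direction to a multiple of a difference of consecutive residuals, since the step
  lengths are nonzero.\<close>

lemma matrix_mult_cocg_residual_in_span:
  assumes nb: "cocg_no_breakdown B b x0 n" and "k < n"
  shows "B *v cocg_residual B b x0 k \<in> vec.span (cocg_residual B b x0 ` {..Suc k})"
proof -
  have Bp: "B *v cocg_direction B b x0 j \<in> vec.span (cocg_residual B b x0 ` {..Suc k})"
    if "j \<le> k" for j
    using that \<open>k < n\<close> matrix_mult_cocg_direction[OF nb, of j]
    by (simp only:) (intro vec.span_scale vec.span_diff vec.span_base; simp)
  show ?thesis
  proof (cases k)
    case 0
    then show ?thesis using Bp[of 0] by (simp add: cocg_0)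
  next
    case (Suc j)
    have "cocg_residual B b x0 k =
        cocg_direction B b x0 k - cocg_beta B b x0 j *s cocg_direction B b x0 j"
      by (simp add: Suc cocg_Suc(3))
    then show ?thesis
      using Bp[of k] Bp[of j] Suc
      by (simp add: matrix_vector_mult_diff_distrib vector_scalar_commute
          vec.span_diff vec.span_scale)
  qed
qed

lemma matrix_mult_cocg_span:
  assumes nb: "cocg_no_breakdown B b x0 n" and "k < n"
    and "v \<in> vec.span (cocg_residual B b x0 ` {..k})"
  shows "B *v v \<in> vec.span (cocg_residual B b x0 ` {..Suc k})"
  using assms(3)
proof (induction rule: vec.span_induct_alt)
  case base
  then show ?case by (simp add: vec.span_zero)
next
  case (step c x y)
  then obtain j where j: "j \<le> k" "x = cocg_residual B b x0 j" by auto
  have "B *v x \<in> vec.span (cocg_residual B b x0 ` {..Suc j})"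
    using matrix_mult_cocg_residual_in_span[OF nb, of j] j \<open>k < n\<close> by simp
  then have "B *v x \<in> vec.span (cocg_residual B b x0 ` {..Suc k})"
    by (rule subsetD[OF vec.span_mono, rotated]) (use j in auto)
  then show ?case
    using step by (simp add: matrix_vector_right_distrib vector_scalar_commute
        vec.span_add vec.span_scale)
qed

section \<open>Invariance of these spans under a shift\<close>

lemma mat_vector_mult: "mat c *v (v :: 'a::comm_semiring_1 ^ 'n) = c *s v"
  by (simp add: vec_eq_iff matrix_vector_mult_def mat_def if_distrib if_distribR
      cong: if_cong)

text \<open>With initial guess 0 both runs start from the residual \<open>b\<close>. Each further
  residual of the run for \<open>B\<close> adds a multiple of
  \<open>B p = (B + s I) p - s p\<close>, and the next span of the shifted run contains both
  terms.\<close>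

lemma cocg_span_shift_subset:
  assumes nb: "cocg_no_breakdown (B + mat s) b 0 n" and "k \<le> n"
  shows "vec.span (cocg_residual B b 0 ` {..k}) \<subseteq>
    vec.span (cocg_residual (B + mat s) b 0 ` {..k})"
  using \<open>k \<le> n\<close>
proof (induction k)
  case 0
  then show ?case by (simp add: cocg_0)
next
  case (Suc k)
  let ?K = "\<lambda>k. vec.span (cocg_residual (B + mat s) b 0 ` {..k})"
  have mono: "?K k \<subseteq> ?K (Suc k)"
    by (rule vec.span_mono) auto
  have old: "vec.span (cocg_residual B b 0 ` {..k}) \<subseteq> ?K k"
    using Suc by simp
  have p: "cocg_direction B b 0 k \<in> ?K k"
    by (rule subsetD[OF old cocg_direction_in_span])
  have "(B + mat s) *v cocg_direction B b 0 k - s *s cocg_direction B b 0 k \<in> ?K (Suc k)"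
    using matrix_mult_cocg_span[OF nb _ p] Suc.prems p mono
    by (auto intro!: vec.span_diff vec.span_scale)
  then have "B *v cocg_direction B b 0 k \<in> ?K (Suc k)"
    by (simp add: matrix_vector_mult_add_rdistrib mat_vector_mult)
  moreover have res: "cocg_residual B b 0 j \<in> ?K (Suc k)" if "j \<le> k" for j
    by (rule subsetD[OF mono], rule subsetD[OF old], rule vec.span_base) (use that in simp)
  ultimately have "cocg_residual B b 0 (Suc k) \<in> ?K (Suc k)"
    unfolding cocg_Suc(2)[of B] by (intro vec.span_diff vec.span_scale) simp_all
  with res have "cocg_residual B b 0 ` {..Suc k} \<subseteq> ?K (Suc k)"
    by (auto simp only: le_Suc_eq atMost_iff)
  then show ?case
    by (intro vec.span_minimal vec.subspace_span)
qed

lemma cocg_span_shift: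
  assumes "cocg_no_breakdown B b 0 n" "cocg_no_breakdown (B + mat s) b 0 n" "k \<le> n"
  shows "vec.span (cocg_residual (B + mat s) b 0 ` {..k}) =
    vec.span (cocg_residual B b 0 ` {..k})"
proof -
  \<comment> \<open>Undoing the shift by \<open>- s\<close> exchanges the two runs and gives the
    reverse inclusion.\<close>
  have eq: "B + mat s + mat (- s) = B"
    by (simp add: vec_eq_iff mat_def)
  show ?thesis
    using cocg_span_shift_subset[of B s b n k] assms
      cocg_span_shift_subset[of "B + mat s" "- s" b n k, unfolded eq]
    by blast
qed

theorem corollary1:
  fixes A :: "complex ^ 'n ^ 'n"
    and \<sigma> :: complex
    and b :: "complex ^ 'n"
    and n :: nat
  assumes "complex_symmetric A"
    and "cocg_no_breakdown A b 0 n"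
    and "cocg_no_breakdown (A + mat \<sigma>) b 0 n"
  shows "\<exists>\<pi> :: complex. cocg_residual A b 0 n = \<pi> *s cocg_residual (A + mat \<sigma>) b 0 n"
proof -
  define r where "r = cocg_residual A b 0"
  define s where "s = cocg_residual (A + mat \<sigma>) b 0"
  have symA: "transpose A = A"
    using assms(1) by (simp add: complex_symmetric_def)
  then have symS: "transpose (A + mat \<sigma>) = A + mat \<sigma>"
    by (auto simp: vec_eq_iff transpose_def mat_def)
  have r_orth: "r i \<bullet>\<^sub>T r j = 0" if "i < j" "j \<le> n" for i j
    using cocg_orthogonal[OF symA assms(2)] that by (simp add: r_def)
  have s_orth: "s i \<bullet>\<^sub>T s j = 0" if "i < j" "j \<le> n" for i j
    using cocg_orthogonal[OF symS assms(3)] that by (simp add: s_def)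
  have span_le: "vec.span (s ` {..k}) = vec.span (r ` {..k})" if "k \<le> n" for k
    unfolding r_def s_def by (rule cocg_span_shift[OF assms(2,3) that])
  \<comment> \<open>For \<open>n = 0\<close> both spans are trivial; otherwise the last index is
    \<open>n - 1\<close>.\<close>
  have span_n: "vec.span (s ` {..<n}) = vec.span (r ` {..<n})"
    using span_le[of "n - 1"] by (cases n) (simp_all add: lessThan_Suc_atMost)
  have "r n \<in> vec.span (insert (s n) (s ` {..<n}))"
    using span_le[of n] vec.span_base[of "r n" "r ` {..n}"]
    by (simp flip: lessThan_Suc_atMost add: lessThan_Suc)
  \<comment> \<open>The component of \<open>r n\<close> along \<open>s n\<close> is the scalar
    sought; the remainder is shown to vanish.\<close>
  then obtain c where c: "r n - c *s s n \<in> vec.span (r ` {..<n})"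
    by (auto simp: vec.span_breakdown_eq span_n)
  have "r n - c *s s n = 0"
  proof (rule orthogonal_span_nondegenerate[OF _ _ c])
    fix j assume "j < n"
    \<comment> \<open>\<open>s n\<close> is orthogonal to the earlier residuals of its own run; the
      common span transfers this to those of the other run.\<close>
    then have "r j \<in> vec.span (s ` {..<n})"
      by (simp add: span_n vec.span_base)
    then have "s n \<bullet>\<^sub>T r j = 0"
      by (rule tdot_eq_0_on_span[rotated]) (use s_orth in \<open>auto simp: tdot_commute[of "s n"]\<close>)
    then show "r j \<bullet>\<^sub>T (r n - c *s s n) = 0"
      using r_orth[of j n] \<open>j < n\<close> by (simp add: tdot_linear tdot_commute[of _ "s n"])
    show "r j \<bullet>\<^sub>T r j \<noteq> 0"
      using cocg_no_breakdownD(1)[OF assms(2) \<open>j < n\<close>] by (simp add: r_def)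
  qed (use r_orth in auto)
  then show ?thesis
    by (auto simp: r_def s_def)
qed

end
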